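(* For any $d\in2^{<\omega}$, $s\in\prod_{n<|d|}b(n)$ and $k<\omega$, the set $Q_{d,s,k}\subseteq\mathbb{LE}_b$ is closed-$D$-lim-linked for every non-principal ultrafilter $D$ on $\omega$. In particular, $\mathbb{LE}_b$ is $\sigma$-$(\Lambda(\mathrm{centered})\cap\Lambda^{\mathrm{lim}}_{\mathrm{cuf}})$-linked, i.e. $\mathbb{LE}_b$ is a union of countably many subsets each of which is both centered and closed-$D$-lim-linked for every non-principal ultrafilter $D$ on $\omega$.
   Context: Fix $b\in\omega^\omega$ with $b(n)\geq2^n$ for all $n<\omega$. The poset $\mathbb{LE}_b$: conditions are triples $(d,s,\varphi)$ with $d\in2^{<\omega}$, $s\in\prod_{n<|d|}b(n)$, $\varphi\in\prod_{n<\omega}\mathcal P(b(n))$ such that for some $k<\omega$, $\frac{|\varphi(n)|}{b(n)}\leq 2^{-n/2^k}$ for all $n\geq|d|$. The order is: $(d',s',\varphi')\leq(d,s,\varphi)$ if $d'\supseteq d$, $s'\supseteq s$, $\varphi'(n)\supseteq\varphi(n)$ for all $n<\omega$, and $s'(n)\notin\varphi(n)$ for all $n\in(d')^{-1}(\{1\})\setminus d^{-1}(\{1\})$. $Q_{d,s,k}$ is the set of conditions $(d,s,\varphi)\in\mathbb{LE}_b$ (with first two coordinates exactly $d$ and $s$) such that $\frac{|\varphi(n)|}{b(n)}\leq2^{-n/2^k}$ for all $n\geq|d|$. For a poset $\mathbb P$ and a non-principal ultrafilter $D$ on $\omega$, a set $Q\subseteq\mathbb P$ is $D$-lim-linked if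 there exist a $\mathbb P$-name $\dot D'$ of an ultrafilter on $\omega$ extending $D$ and a function $\lim^D\colon Q^\omega\to\mathbb P$ such that for every $\bar q=\langle q_m:m<\omega\rangle\in Q^\omega$, $\lim^D\bar q\Vdash\{m<\omega:q_m\in\dot G\}\in\dot D'$, where $\dot G$ is the canonical name of the generic filter. If moreover such a function can be chosen with range contained in $Q$, then $Q$ is closed-$D$-lim-linked. A subset of a poset is centered if each of its finite subsets has a common lower bound in the poset. *)

theory Defs
  imports Complex_Main "HOL-Library.Sublist" "HOL-Library.Countable_Set"
begin

section \<open>Ultrafilters on the natural numbers\<close>

definition ultrafilter_on_nat :: "nat set set \<Rightarrow> bool" where
  "ultrafilter_on_nat D \<longleftrightarrow>
     UNIV \<in> D \<and> {} \<notin> D \<and>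
     (\<forall>A B. A \<in> D \<and> A \<subseteq> B \<longrightarrow> B \<in> D) \<and>
     (\<forall>A B. A \<in> D \<and> B \<in> D \<longrightarrow> A \<inter> B \<in> D) \<and>
     (\<forall>A. A \<in> D \<or> - A \<in> D)"

definition nonprincipal_ultrafilter :: "nat set set \<Rightarrow> bool" where
  "nonprincipal_ultrafilter D \<longleftrightarrow>
     ultrafilter_on_nat D \<and> (\<nexists>n. D = {A. n \<in> A})"


section \<open>Forcing\<close>

text \<open>
  Smaller conditions are stronger. There is no type of all names, but only two levels of names are
  needed. A name of a subset of a ground-model set \<open>'a\<close> is a set of pairs \<open>(x, p)\<close>, standing for the
  usual name consisting of the pairs (check name of \<open>x\<close>, \<open>p\<close>); a name of a family of subsets of \<open>'a\<close>
  is a set of pairs \<open>(\<tau>, p)\<close> with \<open>\<tau>\<close> a name of the first level. Every set of naturals and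
  every family of sets of naturals in the generic extension is the value of such a name.

  A sentence of the forcing language is identified with the predicate telling which conditions force
  it; the connectives below are the clauses of the recursive definition of the forcing relation. The clause for
  implication is correct because every sentence built here is forced by \<open>p\<close> iff it is forced by a
  dense set of conditions below \<open>p\<close>.
\<close>

type_synonym ('a, 'p) set_name = "('a \<times> 'p) set"
type_synonym ('a, 'p) family_name = "(('a, 'p) set_name \<times> 'p) set"
type_synonym 'p sentence = "'p \<Rightarrow> bool"

locale forcing_poset =
  fixes P :: "'p set" and le :: "'p \<Rightarrow> 'p \<Rightarrow> bool" (infix "\<preceq>" 50)
  assumes nonempty: "P \<noteq> {}"
    and refl: "reflp_on P (\<preceq>)"
    and trans: "transp_on P (\<preceq>)"
    and antisym: "antisymp_on P (\<preceq>)"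
begin

definition dense_below :: "'p \<Rightarrow> 'p set \<Rightarrow> bool" where
  "dense_below p A \<longleftrightarrow> (\<forall>q\<in>P. q \<preceq> p \<longrightarrow> (\<exists>r\<in>P. r \<preceq> q \<and> r \<in> A))"

definition f_not :: "'p sentence \<Rightarrow> 'p sentence" ("\<^bold>\<not> _" [40] 40) where
  "(\<^bold>\<not> \<phi>) p \<longleftrightarrow> (\<forall>q\<in>P. q \<preceq> p \<longrightarrow> \<not> \<phi> q)"

definition f_and :: "'p sentence \<Rightarrow> 'p sentence \<Rightarrow> 'p sentence" (infixr "\<^bold>\<and>" 35) where
  "(\<phi> \<^bold>\<and> \<psi>) p \<longleftrightarrow> \<phi> p \<and> \<psi> p"

definition f_or :: "'p sentence \<Rightarrow> 'p sentence \<Rightarrow> 'p sentence" (infixr "\<^bold>\<or>" 30) where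
  "(\<phi> \<^bold>\<or> \<psi>) p \<longleftrightarrow> dense_below p {r. \<phi> r \<or> \<psi> r}"

definition f_imp :: "'p sentence \<Rightarrow> 'p sentence \<Rightarrow> 'p sentence" (infixr "\<^bold>\<longrightarrow>" 25) where
  "(\<phi> \<^bold>\<longrightarrow> \<psi>) p \<longleftrightarrow> (\<forall>q\<in>P. q \<preceq> p \<longrightarrow> \<phi> q \<longrightarrow> \<psi> q)"

definition f_iff :: "'p sentence \<Rightarrow> 'p sentence \<Rightarrow> 'p sentence" (infixr "\<^bold>\<longleftrightarrow>" 25) where
  "(\<phi> \<^bold>\<longleftrightarrow> \<psi>) = ((\<phi> \<^bold>\<longrightarrow> \<psi>) \<^bold>\<and> (\<psi> \<^bold>\<longrightarrow> \<phi>))"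

definition f_all :: "'x set \<Rightarrow> ('x \<Rightarrow> 'p sentence) \<Rightarrow> 'p sentence" where
  "f_all X \<Phi> p \<longleftrightarrow> (\<forall>x\<in>X. \<Phi> x p)"

definition set_names :: "('a, 'p) set_name set" where
  "set_names = Pow (UNIV \<times> P)"

definition family_names :: "('a, 'p) family_name set" where
  "family_names = Pow (set_names \<times> P)"

definition f_mem :: "'a \<Rightarrow> ('a, 'p) set_name \<Rightarrow> 'p sentence" (infix "\<^bold>\<in>" 50) where
  "(x \<^bold>\<in> \<tau>) p \<longleftrightarrow> dense_below p {r. \<exists>c. (x, c) \<in> \<tau> \<and> r \<preceq> c}"

definition f_subset :: "('a, 'p) set_name \<Rightarrow> ('a, 'p) set_name \<Rightarrow> 'p sentence"
    (infix "\<^bold>\<subseteq>" 50) where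
  "(\<sigma> \<^bold>\<subseteq> \<tau>) = f_all UNIV (\<lambda>x. x \<^bold>\<in> \<sigma> \<^bold>\<longrightarrow> x \<^bold>\<in> \<tau>)"

definition f_eq :: "('a, 'p) set_name \<Rightarrow> ('a, 'p) set_name \<Rightarrow> 'p sentence"
    (infix "\<^bold>=" 50) where
  "(\<sigma> \<^bold>= \<tau>) = f_all UNIV (\<lambda>x. x \<^bold>\<in> \<sigma> \<^bold>\<longleftrightarrow> x \<^bold>\<in> \<tau>)"

definition f_mem_family :: "('a, 'p) set_name \<Rightarrow> ('a, 'p) family_name \<Rightarrow> 'p sentence"
    (infix "\<^bold>\<in>\<^bold>\<in>" 50) where
  "(\<sigma> \<^bold>\<in>\<^bold>\<in> F) p \<longleftrightarrow> dense_below p {r. \<exists>\<tau> c. (\<tau>, c) \<in> F \<and> r \<preceq> c \<and> (\<sigma> \<^bold>= \<tau>) r}"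

definition f_subset_family :: "('a, 'p) family_name \<Rightarrow> ('a, 'p) family_name \<Rightarrow> 'p sentence" where
  "f_subset_family E F = f_all set_names (\<lambda>\<sigma>. \<sigma> \<^bold>\<in>\<^bold>\<in> E \<^bold>\<longrightarrow> \<sigma> \<^bold>\<in>\<^bold>\<in> F)"

definition f_ultrafilter :: "(nat, 'p) family_name \<Rightarrow> 'p sentence" where
  "f_ultrafilter F =
     (f_all set_names (\<lambda>\<rho>. f_all UNIV (\<lambda>n. n \<^bold>\<in> \<rho>) \<^bold>\<longrightarrow> \<rho> \<^bold>\<in>\<^bold>\<in> F) \<^bold>\<and>
      f_all set_names (\<lambda>\<rho>. f_all UNIV (\<lambda>n. \<^bold>\<not> n \<^bold>\<in> \<rho>) \<^bold>\<longrightarrow> (\<^bold>\<not> \<rho> \<^bold>\<in>\<^bold>\<in> F)) \<^bold>\<and>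
      f_all set_names (\<lambda>\<sigma>. f_all set_names (\<lambda>\<tau>.
        \<sigma> \<^bold>\<in>\<^bold>\<in> F \<^bold>\<and> \<sigma> \<^bold>\<subseteq> \<tau> \<^bold>\<longrightarrow> \<tau> \<^bold>\<in>\<^bold>\<in> F)) \<^bold>\<and>
      f_all set_names (\<lambda>\<sigma>. f_all set_names (\<lambda>\<tau>. f_all set_names (\<lambda>\<rho>.
        \<sigma> \<^bold>\<in>\<^bold>\<in> F \<^bold>\<and> \<tau> \<^bold>\<in>\<^bold>\<in> F \<^bold>\<and> f_all UNIV (\<lambda>n. n \<^bold>\<in> \<rho> \<^bold>\<longleftrightarrow> (n \<^bold>\<in> \<sigma> \<^bold>\<and> n \<^bold>\<in> \<tau>)) \<^bold>\<longrightarrow>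
        \<rho> \<^bold>\<in>\<^bold>\<in> F))) \<^bold>\<and>
      f_all set_names (\<lambda>\<sigma>. f_all set_names (\<lambda>\<rho>.
        f_all UNIV (\<lambda>n. n \<^bold>\<in> \<rho> \<^bold>\<longleftrightarrow> (\<^bold>\<not> n \<^bold>\<in> \<sigma>)) \<^bold>\<longrightarrow> (\<sigma> \<^bold>\<in>\<^bold>\<in> F \<^bold>\<or> \<rho> \<^bold>\<in>\<^bold>\<in> F))))"

definition check_set :: "'a set \<Rightarrow> ('a, 'p) set_name" where
  "check_set X = X \<times> P"

definition check_family :: "'a set set \<Rightarrow> ('a, 'p) family_name" where
  "check_family D = (check_set ` D) \<times> P"

definition ultrafilter_name_extending :: "nat set set \<Rightarrow> (nat, 'p) family_name \<Rightarrow> bool" where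
  "ultrafilter_name_extending D F \<longleftrightarrow>
     F \<in> family_names \<and>
     (\<forall>p\<in>P. (f_ultrafilter F \<^bold>\<and> f_subset_family (check_family D) F) p)"

definition comprehension_name :: "('a \<Rightarrow> 'p sentence) \<Rightarrow> ('a, 'p) set_name" where
  "comprehension_name \<Phi> = {(x, p). p \<in> P \<and> \<Phi> x p}"

definition generic_name :: "('p, 'p) set_name" where
  "generic_name = {(p, p) | p. p \<in> P}"

text \<open>
  Below, \<open>F\<close> names the ultrafilter extending \<open>D\<close>, and \<open>L\<close> is the limit function from sequences in
  \<open>Q\<close> to \<open>R\<close>; its values on other sequences are irrelevant. The comprehension name is that
  of the set of all \<open>m\<close> such that \<open>q m\<close> belongs to the generic filter.
\<close>

definition lim_witness ::
    "nat set set \<Rightarrow> 'p set \<Rightarrow> 'p set \<Rightarrow> (nat, 'p) family_name \<Rightarrow> ((nat \<Rightarrow> 'p) \<Rightarrow> 'p) \<Rightarrow> bool" where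
  "lim_witness D Q R F L \<longleftrightarrow>
     ultrafilter_name_extending D F \<and>
     (\<forall>q. (\<forall>m. q m \<in> Q) \<longrightarrow>
        L q \<in> R \<and> (comprehension_name (\<lambda>m. q m \<^bold>\<in> generic_name) \<^bold>\<in>\<^bold>\<in> F) (L q))"

definition lim_linked :: "nat set set \<Rightarrow> 'p set \<Rightarrow> bool" where
  "lim_linked D Q \<longleftrightarrow> Q \<subseteq> P \<and> (\<exists>F L. lim_witness D Q P F L)"

definition closed_lim_linked :: "nat set set \<Rightarrow> 'p set \<Rightarrow> bool" where
  "closed_lim_linked D Q \<longleftrightarrow> Q \<subseteq> P \<and> (\<exists>F L. lim_witness D Q Q F L)"

definition centered :: "'p set \<Rightarrow> bool" where
  "centered Q \<longleftrightarrow>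
     Q \<subseteq> P \<and> (\<forall>A. finite A \<and> A \<subseteq> Q \<longrightarrow> (\<exists>p\<in>P. \<forall>q\<in>A. p \<preceq> q))"

definition Lambda_centered :: "'p set set" where
  "Lambda_centered = {Q. centered Q}"

definition Lambda_lim_cuf :: "'p set set" where
  "Lambda_lim_cuf = {Q. \<forall>D. nonprincipal_ultrafilter D \<longrightarrow> closed_lim_linked D Q}"

definition sigma_linked :: "'p set set \<Rightarrow> bool" where
  "sigma_linked \<Gamma> \<longleftrightarrow> (\<exists>\<Q>. countable \<Q> \<and> \<Q> \<subseteq> \<Gamma> \<and> \<Union>\<Q> = P)"

end


section \<open>The poset \<open>LE\<^sub>b\<close>\<close>

text \<open>
  Finite 0-1 sequences are boolean lists, with \<open>True\<close> for 1, and \<open>b n\<close>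
  as a set is \<open>{..<b n}\<close>.
\<close>

type_synonym le_condition = "bool list \<times> nat list \<times> (nat \<Rightarrow> nat set)"

definition bounded_seqs :: "(nat \<Rightarrow> nat) \<Rightarrow> nat \<Rightarrow> nat list set" where
  "bounded_seqs b l = {s. length s = l \<and> (\<forall>n<l. s ! n < b n)}"

definition slalom_bound :: "(nat \<Rightarrow> nat) \<Rightarrow> nat \<Rightarrow> nat \<Rightarrow> (nat \<Rightarrow> nat set) \<Rightarrow> bool" where
  "slalom_bound b l k \<phi> \<longleftrightarrow>
     (\<forall>n\<ge>l. real (card (\<phi> n)) / real (b n) \<le> 2 powr (- (real n / 2 ^ k)))"

definition LE :: "(nat \<Rightarrow> nat) \<Rightarrow> le_condition set" where
  "LE b = {(d, s, \<phi>). s \<in> bounded_seqs b (length d) \<and> (\<forall>n. \<phi> n \<subseteq> {..<b n}) \<and>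
                      (\<exists>k. slalom_bound b (length d) k \<phi>)}"

definition ones :: "bool list \<Rightarrow> nat set" where
  "ones d = {n. n < length d \<and> d ! n}"

fun LE_le :: "le_condition \<Rightarrow> le_condition \<Rightarrow> bool" where
  "LE_le (d', s', \<phi>') (d, s, \<phi>) \<longleftrightarrow>
     prefix d d' \<and> prefix s s' \<and> (\<forall>n. \<phi> n \<subseteq> \<phi>' n) \<and>
     (\<forall>n \<in> ones d' - ones d. s' ! n \<notin> \<phi> n)"

definition LE_Q :: "(nat \<Rightarrow> nat) \<Rightarrow> bool list \<Rightarrow> nat list \<Rightarrow> nat \<Rightarrow> le_condition set" where
  "LE_Q b d s k = {(d', s', \<phi>) \<in> LE b. d' = d \<and> s' = s \<and> slalom_bound b (length d) k \<phi>}"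

lemma LE_le_trans:
  assumes "y \<in> LE b" "LE_le x y" "LE_le y z"
  shows "LE_le x z"
proof -
  obtain d'' s'' \<phi>'' where x: "x = (d'', s'', \<phi>'')" by (rule prod_cases3)
  obtain d' s' \<phi>' where y: "y = (d', s', \<phi>')" by (rule prod_cases3)
  obtain d s \<phi> where z: "z = (d, s, \<phi>)" by (rule prod_cases3)
  note xyz = x y z
  have len: "length s' = length d'"
    using assms(1) by (simp add: xyz LE_def bounded_seqs_def)
  have yz: "prefix d d'" "prefix s s'" "\<forall>n. \<phi> n \<subseteq> \<phi>' n" "\<forall>n \<in> ones d' - ones d. s' ! n \<notin> \<phi> n"
    using assms(3) unfolding xyz LE_le.simps by blast+
  have xy: "prefix d' d''" "prefix s' s''" "\<forall>n. \<phi>' n \<subseteq> \<phi>'' n"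
      "\<forall>n \<in> ones d'' - ones d'. s'' ! n \<notin> \<phi>' n"
    using assms(2) unfolding xyz LE_le.simps by blast+
  have "\<forall>n \<in> ones d'' - ones d. s'' ! n \<notin> \<phi> n"
  proof
    fix n assume n: "n \<in> ones d'' - ones d"
    show "s'' ! n \<notin> \<phi> n"
    proof (cases "n \<in> ones d'")
      case True
      then have "n < length s'" by (simp add: ones_def len)
      then have "s'' ! n = s' ! n"
        using xy(2) by (elim prefixE) (simp add: nth_append)
      then show ?thesis using yz(4) True n by simp
    next
      case False
      then show ?thesis using xy(4) yz(3) n by blast
    qed
  qed
  moreover have "prefix d d''" "prefix s s''"
    using xy(1,2) yz(1,2) prefix_order.trans by blast+
  moreover have "\<forall>n. \<phi> n \<subseteq> \<phi>'' n"
    using xy(3) yz(3) by blast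
  ultimately show ?thesis
    unfolding xyz LE_le.simps by blast
qed

lemma LE_forcing_poset: "forcing_poset (LE b) LE_le"
proof
  have "([], [], \<lambda>_. {}) \<in> LE b"
    by (simp add: LE_def bounded_seqs_def slalom_bound_def)
  then show "LE b \<noteq> {}" by blast
  show "reflp_on (LE b) LE_le"
    by (rule reflp_onI) (auto simp: LE_def)
  show "transp_on (LE b) LE_le"
    by (rule transp_onI) (rule LE_le_trans)
  show "antisymp_on (LE b) LE_le"
  proof (rule antisymp_onI)
    fix x y assume le: "LE_le x y" "LE_le y x"
    obtain d s \<phi> where x: "x = (d, s, \<phi>)" by (rule prod_cases3)
    obtain d' s' \<phi>' where y: "y = (d', s', \<phi>')" by (rule prod_cases3)
    have "d = d'" "s = s'"
      using le unfolding x y LE_le.simps by (blast intro: prefix_order.antisym)+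
    moreover have "\<phi> = \<phi>'"
      using le unfolding x y LE_le.simps by (intro ext subset_antisym) blast+
    ultimately show "x = y"
      by (simp add: x y)
  qed
qed

end

theory Submission
  imports Defs
begin

text \<open>
  The limit of a sequence of conditions \<open>(d, s, \<phi>\<^sub>m)\<close> is \<open>(d, s, \<phi>)\<close>, where \<open>\<phi> n\<close> is the
  \<open>D\<close>-limit of the sets \<open>\<phi>\<^sub>m n\<close>. These are subsets of a fixed finite set, so \<open>\<phi> n\<close> is equal
  to \<open>\<phi>\<^sub>m n\<close> for \<open>D\<close>-many \<open>m\<close>, and therefore obeys the same bound on its size: the limit stays
  in \<open>LE_Q b d s k\<close>.

  Two facts turn this into a proof of linkedness. The first is about forcing in general
  (\<open>lim_witness_if_compatible\<close>): an ultrafilter name witnessing that \<open>L\<close> is a limit function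
  exists as soon as, below every condition \<open>p\<close> that extends finitely many limits \<open>L q\<close>, and for
  every \<open>A \<in> D\<close>, there are \<open>m \<in> A\<close> and \<open>r \<preceq> p\<close> extending all the \<open>q m\<close>. This says that \<open>D\<close>
  together with the sets \<open>{m. q m \<in> G}\<close> for \<open>L q \<in> G\<close> is forced to have the finite intersection
  property; a maximal family name with this property, obtained from Zorn's lemma, is forced to be an
  ultrafilter (\<open>maximal_fip_ultrafilter\<close>).

  The second fact is about the poset (\<open>common_extension\<close>): if \<open>p\<close> respects the finitely many
  promises \<open>\<phi>\<close> made by conditions \<open>(d, s, \<phi>)\<close> with \<open>d\<close> and \<open>s\<close> initial segments of those of
  \<open>p\<close>, then one extension of \<open>p\<close> lies below all of them. It takes the union of all the slaloms,
  and appends so many zeros to the first coordinate of \<open>p\<close> that the bound, which needs to hold only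
  from there on, absorbs the number of slaloms at the cost of increasing \<open>k\<close> by one. Positions with
  value zero carry no obligation. Centredness is immediate from this. For limits, a condition \<open>p\<close>
  below \<open>L q\<close> avoids \<open>\<phi> n\<close> at finitely many new positions \<open>n\<close>, hence avoids \<open>\<phi>\<^sub>m n\<close> at the
  same positions for \<open>D\<close>-many \<open>m\<close>.
\<close>


section \<open>Ultrafilters\<close>

lemma ultrafilter_mono:
  assumes "ultrafilter_on_nat D" "A \<in> D" "A \<subseteq> B"
  shows "B \<in> D"
  using assms unfolding ultrafilter_on_nat_def by blast

lemma ultrafilter_Compl:
  assumes "ultrafilter_on_nat D" "A \<notin> D"
  shows "- A \<in> D"
  using assms unfolding ultrafilter_on_nat_def by blast

lemma ultrafilter_nonempty:
  assumes "ultrafilter_on_nat D" "A \<in> D"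
  shows "A \<noteq> {}"
  using assms unfolding ultrafilter_on_nat_def by blast

lemma ultrafilter_Int:
  assumes "ultrafilter_on_nat D" "A \<in> D" "B \<in> D"
  shows "A \<inter> B \<in> D"
  using assms unfolding ultrafilter_on_nat_def by blast

lemma ultrafilter_INT:
  assumes "ultrafilter_on_nat D" "finite I" "\<And>i. i \<in> I \<Longrightarrow> A i \<in> D"
  shows "(\<Inter>i\<in>I. A i) \<in> D"
  using assms(2,3)
proof (induction I)
  case empty
  then show ?case using assms(1) by (simp add: ultrafilter_on_nat_def)
next
  case (insert i I)
  then show ?case using ultrafilter_Int[OF assms(1)] by simp
qed

lemma ultrafilter_pigeonhole:
  assumes D: "ultrafilter_on_nat D" and fin: "finite (range f)"
  shows "\<exists>x. {m. f m = x} \<in> D"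
proof (rule ccontr)
  assume "\<nexists>x. {m. f m = x} \<in> D"
  then have "(\<Inter>x\<in>range f. - {m. f m = x}) \<in> D"
    using ultrafilter_Compl[OF D] by (intro ultrafilter_INT[OF D fin]) blast
  moreover have "(\<Inter>x\<in>range f. - {m. f m = x}) = {}" by auto
  ultimately show False using ultrafilter_nonempty[OF D] by blast
qed


section \<open>Names of ultrafilters\<close>

context forcing_poset
begin

lemma preceq_refl: "p \<in> P \<Longrightarrow> p \<preceq> p"
  using refl by (rule reflp_onD)

lemma preceq_trans: "p \<preceq> q \<Longrightarrow> q \<preceq> r \<Longrightarrow> p \<in> P \<Longrightarrow> q \<in> P \<Longrightarrow> r \<in> P \<Longrightarrow> p \<preceq> r"
  using trans by (blast dest: transp_onD)

lemma dense_below_mono: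
  assumes "dense_below p A" "q \<preceq> p" "p \<in> P" "q \<in> P"
  shows "dense_below q A"
  using assms preceq_trans unfolding dense_below_def by meson

lemma dense_below_idem:
  assumes "p \<in> P" "dense_below p {r. dense_below r A}"
  shows "dense_below p A"
  using assms unfolding dense_below_def mem_Collect_eq
  by (meson preceq_refl preceq_trans)

lemma f_mem_mono:
  assumes "(x \<^bold>\<in> \<tau>) p" "q \<preceq> p" "p \<in> P" "q \<in> P"
  shows "(x \<^bold>\<in> \<tau>) q"
  using assms dense_below_mono unfolding f_mem_def by blast

lemma f_mem_if_dense:
  assumes "p \<in> P" "dense_below p {r. (x \<^bold>\<in> \<tau>) r}"
  shows "(x \<^bold>\<in> \<tau>) p"
  using assms dense_below_idem unfolding f_mem_def by blast

lemma f_memI: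
  assumes "(x, c) \<in> \<tau>" "c \<in> P" "p \<in> P" "p \<preceq> c"
  shows "(x \<^bold>\<in> \<tau>) p"
  using assms unfolding f_mem_def dense_below_def mem_Collect_eq
  by (meson preceq_refl preceq_trans)

lemma f_eq_memD:
  assumes "(\<sigma> \<^bold>= \<tau>) p" "q \<preceq> p" "q \<in> P" "(x \<^bold>\<in> \<tau>) q"
  shows "(x \<^bold>\<in> \<sigma>) q"
  using assms unfolding f_eq_def f_all_def f_iff_def f_and_def f_imp_def by blast

lemma f_eq_refl: "(\<sigma> \<^bold>= \<sigma>) p"
  unfolding f_eq_def f_all_def f_iff_def f_and_def f_imp_def by blast

lemma f_mem_familyI:
  assumes "(\<sigma>, c) \<in> F" "c \<in> P" "p \<in> P" "p \<preceq> c"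
  shows "(\<sigma> \<^bold>\<in>\<^bold>\<in> F) p"
  using assms f_eq_refl unfolding f_mem_family_def dense_below_def mem_Collect_eq
  by (meson preceq_refl preceq_trans)

lemma f_mem_family_mono:
  assumes "(\<sigma> \<^bold>\<in>\<^bold>\<in> F) p" "F \<subseteq> F'"
  shows "(\<sigma> \<^bold>\<in>\<^bold>\<in> F') p"
  using assms unfolding f_mem_family_def dense_below_def by blast

text \<open>
  The finite intersection property as a property of the set of pairs \<open>F\<close> itself: it is forced by
  every condition that the value of \<open>F\<close> has the finite intersection property. In this form it passes
  to unions of chains, which makes Zorn's lemma applicable to names instead of families in an extension.
\<close>

definition forced_fip :: "(nat, 'p) family_name \<Rightarrow> bool" where
  "forced_fip F \<longleftrightarrow>
     (\<forall>S p. finite S \<longrightarrow> S \<subseteq> F \<longrightarrow> p \<in> P \<longrightarrow> (\<forall>x\<in>S. p \<preceq> snd x) \<longrightarrow>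
        (\<exists>r\<in>P. r \<preceq> p \<and> (\<exists>n. \<forall>x\<in>S. (n \<^bold>\<in> fst x) r)))"

lemma forced_fipD:
  assumes "forced_fip F" "finite S" "S \<subseteq> F" "p \<in> P" "\<And>x. x \<in> S \<Longrightarrow> p \<preceq> snd x"
  obtains r n where "r \<in> P" "r \<preceq> p" "\<And>x. x \<in> S \<Longrightarrow> (n \<^bold>\<in> fst x) r"
proof -
  have "\<forall>x\<in>S. p \<preceq> snd x" using assms(5) by (rule ballI)
  then have "\<exists>r\<in>P. r \<preceq> p \<and> (\<exists>n. \<forall>x\<in>S. (n \<^bold>\<in> fst x) r)"
    using assms(1-4) unfolding forced_fip_def by simp
  then obtain r n where "r \<in> P" "r \<preceq> p" "\<forall>x\<in>S. (n \<^bold>\<in> fst x) r"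
    by (elim bexE conjE exE)
  then show thesis by (intro that[of r n]) simp_all
qed

definition maximal_fip :: "(nat, 'p) family_name \<Rightarrow> bool" where
  "maximal_fip F \<longleftrightarrow> F \<in> family_names \<and> forced_fip F \<and>
     (\<forall>F'. F' \<in> family_names \<longrightarrow> forced_fip F' \<longrightarrow> F \<subseteq> F' \<longrightarrow> F' = F)"

lemma maximal_fip_exists:
  assumes "F\<^sub>0 \<in> family_names" "forced_fip F\<^sub>0"
  obtains F where "maximal_fip F" "F\<^sub>0 \<subseteq> F"
proof -
  define \<A> where "\<A> = {F \<in> family_names. forced_fip F \<and> F\<^sub>0 \<subseteq> F}"
  have "\<exists>M\<in>\<A>. \<forall>X\<in>\<A>. M \<subseteq> X \<longrightarrow> X = M"
  proof (rule subset_Zorn_nonempty)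
    show "\<A> \<noteq> {}" using assms by (auto simp: \<A>_def)
  next
    fix C assume ne: "C \<noteq> {}" and chain: "subset.chain \<A> C"
    then have sub: "C \<subseteq> \<A>" by (simp add: subset.chain_def)
    have "forced_fip (\<Union>C)"
      unfolding forced_fip_def
    proof (intro allI impI)
      fix S p assume S: "finite S" "S \<subseteq> \<Union>C" and p: "p \<in> P" "\<forall>x\<in>S. p \<preceq> snd x"
      from finite_subset_Union_chain[OF S ne chain] obtain F where "F \<in> C" "S \<subseteq> F" by blast
      then have "forced_fip F" using sub by (auto simp: \<A>_def)
      then show "\<exists>r\<in>P. r \<preceq> p \<and> (\<exists>n. \<forall>x\<in>S. (n \<^bold>\<in> fst x) r)"
        using S(1) \<open>S \<subseteq> F\<close> p unfolding forced_fip_def by blast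
    qed
    moreover have "\<Union>C \<in> family_names" "F\<^sub>0 \<subseteq> \<Union>C"
      using sub ne unfolding \<A>_def family_names_def by blast+
    ultimately show "\<Union>C \<in> \<A>" by (simp add: \<A>_def)
  qed
  then obtain F where "F \<in> \<A>" and max: "\<And>X. X \<in> \<A> \<Longrightarrow> F \<subseteq> X \<Longrightarrow> X = F" by metis
  then have F: "F \<in> family_names" "forced_fip F" "F\<^sub>0 \<subseteq> F" by (simp_all add: \<A>_def)
  moreover have "F' = F" if "F' \<in> family_names" "forced_fip F'" "F \<subseteq> F'" for F'
  proof (rule max[OF _ that(3)])
    show "F' \<in> \<A>" using that F(3) by (simp add: \<A>_def subset_trans[OF F(3) that(3)])
  qed
  ultimately show thesis using that unfolding maximal_fip_def by blast
qed

text \<open>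
  Maximality is only ever used through the following membership test for \<open>F\<close>: a pair can be added
  if it does not destroy the forced finite intersection property.
\<close>

lemma maximal_fip_mem:
  assumes F: "maximal_fip F" and \<sigma>: "\<sigma> \<in> set_names" and p: "p \<in> P"
    and add: "\<And>S q. finite S \<Longrightarrow> S \<subseteq> F \<Longrightarrow> q \<in> P \<Longrightarrow> q \<preceq> p \<Longrightarrow> (\<And>x. x \<in> S \<Longrightarrow> q \<preceq> snd x)
      \<Longrightarrow> \<exists>r\<in>P. r \<preceq> q \<and> (\<exists>n. (n \<^bold>\<in> \<sigma>) r \<and> (\<forall>x\<in>S. (n \<^bold>\<in> fst x) r))"
  shows "(\<sigma>, p) \<in> F"
proof -
  have "forced_fip (insert (\<sigma>, p) F)"
    unfolding forced_fip_def
  proof (intro allI impI)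
    fix S q
    assume S: "finite S" "S \<subseteq> insert (\<sigma>, p) F" and q: "q \<in> P" "\<forall>x\<in>S. q \<preceq> snd x"
    show "\<exists>r\<in>P. r \<preceq> q \<and> (\<exists>n. \<forall>x\<in>S. (n \<^bold>\<in> fst x) r)"
    proof (cases "(\<sigma>, p) \<in> S")
      case True
      then have "q \<preceq> p" using q(2) by force
      with S q have "\<exists>r\<in>P. r \<preceq> q \<and> (\<exists>n. (n \<^bold>\<in> \<sigma>) r \<and> (\<forall>x\<in>S - {(\<sigma>, p)}. (n \<^bold>\<in> fst x) r))"
        by (intro add) auto
      then obtain r n where r: "r \<in> P" "r \<preceq> q" "(n \<^bold>\<in> \<sigma>) r"
          "\<forall>x\<in>S - {(\<sigma>, p)}. (n \<^bold>\<in> fst x) r" by blast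
      then have "\<forall>x\<in>S. (n \<^bold>\<in> fst x) r" by (metis DiffI fst_conv singletonD)
      with r(1,2) show ?thesis by blast
    next
      case False
      then have "S \<subseteq> F" using S(2) by blast
      with F S(1) q show ?thesis unfolding maximal_fip_def forced_fip_def by blast
    qed
  qed
  moreover have "insert (\<sigma>, p) F \<in> family_names"
    using F \<sigma> p by (auto simp: maximal_fip_def family_names_def)
  ultimately show ?thesis using F unfolding maximal_fip_def by blast
qed

text \<open>
  For a maximal \<open>F\<close> the statement that \<open>\<sigma>\<close> belongs to \<open>F\<close> is forced by exactly those \<open>p\<close> with
  \<open>(\<sigma>, p) \<in> F\<close>, so each clause of the definition of an ultrafilter becomes a question about pairs.
  That the empty set is not in \<open>F\<close> is the forced finite intersection property; the other clauses follow
  from the membership test. For the last one, if \<open>(\<rho>, q)\<close> cannot be added, some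
  finitely many members of \<open>F\<close> are forced by some \<open>q' \<preceq> q\<close> to have an intersection disjoint from
  \<open>\<rho>\<close>, that is, contained in its complement \<open>\<sigma>\<close>; then \<open>(\<sigma>, q')\<close> can be added.
\<close>

lemma maximal_fip_ultrafilter:
  assumes F: "maximal_fip F" and p: "p \<in> P"
  shows "f_ultrafilter F p"
proof -
  note mem = maximal_fip_mem[OF F]
  have names: "F \<in> family_names" and fip: "forced_fip F" using F by (simp_all add: maximal_fip_def)
  have below_snd: "q' \<preceq> snd x" if "x \<in> F" "q' \<preceq> q" "q \<preceq> snd x" "q' \<in> P" "q \<in> P" for x q q'
  proof -
    have "snd x \<in> P" using that(1) names by (auto simp: family_names_def)
    then show ?thesis by (rule preceq_trans[OF that(2-5)])
  qed
  have iff: "(\<sigma> \<^bold>\<in>\<^bold>\<in> F) p \<longleftrightarrow> (\<sigma>, p) \<in> F" if \<sigma>: "\<sigma> \<in> set_names" and p: "p \<in> P" for \<sigma> p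
  proof
    assume "(\<sigma>, p) \<in> F"
    then show "(\<sigma> \<^bold>\<in>\<^bold>\<in> F) p" using p preceq_refl by (blast intro: f_mem_familyI)
  next
    assume inF: "(\<sigma> \<^bold>\<in>\<^bold>\<in> F) p"
    show "(\<sigma>, p) \<in> F"
    proof (rule mem[OF \<sigma> p])
      fix S q assume S: "finite S" "S \<subseteq> F" and q: "q \<in> P" "q \<preceq> p" "\<And>x. x \<in> S \<Longrightarrow> q \<preceq> snd x"
      from inF q obtain r \<tau> c where r: "r \<in> P" "r \<preceq> q" "(\<tau>, c) \<in> F" "r \<preceq> c" "(\<sigma> \<^bold>= \<tau>) r"
        unfolding f_mem_family_def dense_below_def by blast
      have "\<And>x. x \<in> S \<Longrightarrow> r \<preceq> snd x"
        using below_snd[OF _ r(2) q(3) r(1) q(1)] S(2) by blast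
      then have "\<And>x. x \<in> insert (\<tau>, c) S \<Longrightarrow> r \<preceq> snd x" using r by auto
      moreover have "finite (insert (\<tau>, c) S)" "insert (\<tau>, c) S \<subseteq> F" using S r by auto
      ultimately obtain r' n where r': "r' \<in> P" "r' \<preceq> r"
          "\<And>x. x \<in> insert (\<tau>, c) S \<Longrightarrow> (n \<^bold>\<in> fst x) r'"
        using forced_fipD[OF fip _ _ r(1)] by metis
      then have "(n \<^bold>\<in> \<tau>) r'" by force
      then have "(n \<^bold>\<in> \<sigma>) r'" by (rule f_eq_memD[OF r(5) r'(2,1)])
      moreover have "r' \<preceq> q" using r r' q by (blast intro: preceq_trans)
      ultimately show "\<exists>r\<in>P. r \<preceq> q \<and> (\<exists>n. (n \<^bold>\<in> \<sigma>) r \<and> (\<forall>x\<in>S. (n \<^bold>\<in> fst x) r))"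
        using r' by blast
    qed
  qed
  have whole: "(\<rho>, q) \<in> F"
    if \<rho>: "\<rho> \<in> set_names" and q: "q \<in> P" and all: "\<And>n. (n \<^bold>\<in> \<rho>) q" for \<rho> q
  proof (rule mem[OF \<rho> q])
    fix S q' assume S: "finite S" "S \<subseteq> F" and q': "q' \<in> P" "q' \<preceq> q" "\<And>x. x \<in> S \<Longrightarrow> q' \<preceq> snd x"
    from forced_fipD[OF fip S q'(1,3)] obtain r n
      where r: "r \<in> P" "r \<preceq> q'" "\<And>x. x \<in> S \<Longrightarrow> (n \<^bold>\<in> fst x) r" by blast
    then have "(n \<^bold>\<in> \<rho>) r" using all q q' by (meson f_mem_mono)
    then show "\<exists>r\<in>P. r \<preceq> q' \<and> (\<exists>n. (n \<^bold>\<in> \<rho>) r \<and> (\<forall>x\<in>S. (n \<^bold>\<in> fst x) r))"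
      using r by blast
  qed
  have empty: "(\<rho>, q) \<notin> F"
    if q: "q \<in> P" and none: "\<And>n r. r \<in> P \<Longrightarrow> r \<preceq> q \<Longrightarrow> \<not> (n \<^bold>\<in> \<rho>) r" for \<rho> q
  proof
    assume "(\<rho>, q) \<in> F"
    then have "\<exists>r\<in>P. r \<preceq> q \<and> (\<exists>n. \<forall>x\<in>{(\<rho>, q)}. (n \<^bold>\<in> fst x) r)"
      using fip q preceq_refl[OF q] unfolding forced_fip_def
      by (elim allE[of _ "{(\<rho>, q)}"]) auto
    then show False using none by auto
  qed
  \<comment> \<open>Upward closure and closure under intersections in one: the superset of a finite intersection.\<close>
  have finite_meet: "(\<rho>, q) \<in> F"
    if \<rho>: "\<rho> \<in> set_names" and q: "q \<in> P"
      and T: "finite T" "T \<subseteq> F" "\<And>x. x \<in> T \<Longrightarrow> q \<preceq> snd x"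
      and super: "\<And>n r. r \<in> P \<Longrightarrow> r \<preceq> q \<Longrightarrow> (\<And>x. x \<in> T \<Longrightarrow> (n \<^bold>\<in> fst x) r) \<Longrightarrow> (n \<^bold>\<in> \<rho>) r"
    for \<rho> q T
  proof (rule mem[OF \<rho> q])
    fix S q' assume S: "finite S" "S \<subseteq> F" and q': "q' \<in> P" "q' \<preceq> q" "\<And>x. x \<in> S \<Longrightarrow> q' \<preceq> snd x"
    have le: "\<And>x. x \<in> S \<union> T \<Longrightarrow> q' \<preceq> snd x"
      using q'(3) below_snd[OF _ q'(2) T(3) q'(1) q] T(2) by blast
    have "finite (S \<union> T)" "S \<union> T \<subseteq> F" using S T by auto
    from forced_fipD[OF fip this q'(1) le] obtain r n
      where r: "r \<in> P" "r \<preceq> q'" "\<And>x. x \<in> S \<union> T \<Longrightarrow> (n \<^bold>\<in> fst x) r" by blast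
    moreover have "r \<preceq> q" using r q' q by (blast intro: preceq_trans)
    ultimately have "(n \<^bold>\<in> \<rho>) r" using super by blast
    then show "\<exists>r\<in>P. r \<preceq> q' \<and> (\<exists>n. (n \<^bold>\<in> \<rho>) r \<and> (\<forall>x\<in>S. (n \<^bold>\<in> fst x) r))"
      using r by blast
  qed
  have ultra: "\<exists>r\<in>P. r \<preceq> q \<and> ((\<sigma>, r) \<in> F \<or> (\<rho>, r) \<in> F)"
    if \<sigma>: "\<sigma> \<in> set_names" and \<rho>: "\<rho> \<in> set_names" and q: "q \<in> P"
      and compl: "\<And>n r. r \<in> P \<Longrightarrow> r \<preceq> q \<Longrightarrow> (\<And>r'. r' \<in> P \<Longrightarrow> r' \<preceq> r \<Longrightarrow> \<not> (n \<^bold>\<in> \<sigma>) r')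
        \<Longrightarrow> (n \<^bold>\<in> \<rho>) r"
    for \<sigma> \<rho> q
  proof (cases "(\<rho>, q) \<in> F")
    case True
    then show ?thesis using q preceq_refl by blast
  next
    case False
    have "\<exists>T q'. finite T \<and> T \<subseteq> F \<and> q' \<in> P \<and> q' \<preceq> q \<and> (\<forall>x\<in>T. q' \<preceq> snd x) \<and>
        \<not> (\<exists>r\<in>P. r \<preceq> q' \<and> (\<exists>n. (n \<^bold>\<in> \<rho>) r \<and> (\<forall>x\<in>T. (n \<^bold>\<in> fst x) r)))"
      (is ?disjoint_meet)
    proof (rule ccontr)
      assume neg: "\<not> ?disjoint_meet"
      have "(\<rho>, q) \<in> F"
      proof (rule mem[OF \<rho> q], rule ccontr)
        fix T q' assume "finite T" "T \<subseteq> F" "q' \<in> P" "q' \<preceq> q" "\<And>x. x \<in> T \<Longrightarrow> q' \<preceq> snd x"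
          "\<not> (\<exists>r\<in>P. r \<preceq> q' \<and> (\<exists>n. (n \<^bold>\<in> \<rho>) r \<and> (\<forall>x\<in>T. (n \<^bold>\<in> fst x) r)))"
        then have ?disjoint_meet by (intro exI conjI ballI)
        with neg show False by (rule notE)
      qed
      with False show False by blast
    qed
    then obtain T q' where T: "finite T" "T \<subseteq> F" and T_le: "\<forall>x\<in>T. q' \<preceq> snd x"
      and q': "q' \<in> P" "q' \<preceq> q"
      and disj: "\<not> (\<exists>r\<in>P. r \<preceq> q' \<and> (\<exists>n. (n \<^bold>\<in> \<rho>) r \<and> (\<forall>x\<in>T. (n \<^bold>\<in> fst x) r)))"
      by (elim exE conjE)
    have "(\<sigma>, q') \<in> F"
    proof (rule finite_meet[OF \<sigma> q'(1) T bspec[OF T_le]])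
      fix n r assume r: "r \<in> P" "r \<preceq> q'" and inT: "\<And>x. x \<in> T \<Longrightarrow> (n \<^bold>\<in> fst x) r"
      show "(n \<^bold>\<in> \<sigma>) r"
      proof (rule f_mem_if_dense[OF r(1)], unfold dense_below_def, intro ballI impI, rule ccontr)
        fix r1 assume r1: "r1 \<in> P" "r1 \<preceq> r"
          and "\<not> (\<exists>r2\<in>P. r2 \<preceq> r1 \<and> r2 \<in> {r. (n \<^bold>\<in> \<sigma>) r})"
        moreover have r1q': "r1 \<preceq> q'" using r1 r q' by (blast intro: preceq_trans)
        moreover have "r1 \<preceq> q" using r1q' r1 q' q by (blast intro: preceq_trans)
        ultimately have "(n \<^bold>\<in> \<rho>) r1" using compl by blast
        moreover have "\<And>x. x \<in> T \<Longrightarrow> (n \<^bold>\<in> fst x) r1"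
          using inT r1 r by (meson f_mem_mono)
        ultimately show False using disj r1 r1q' by blast
      qed
    qed
    then show ?thesis using q' by blast
  qed
  have up: "(\<tau>, q) \<in> F"
    if "\<tau> \<in> set_names" "q \<in> P" "(\<sigma>, q) \<in> F" "(\<sigma> \<^bold>\<subseteq> \<tau>) q" for \<sigma> \<tau> q
  proof (rule finite_meet[of \<tau> q "{(\<sigma>, q)}"])
    fix n r assume r: "r \<in> P" "r \<preceq> q" and "\<And>x. x \<in> {(\<sigma>, q)} \<Longrightarrow> (n \<^bold>\<in> fst x) r"
    then have "(n \<^bold>\<in> \<sigma>) r" by force
    then show "(n \<^bold>\<in> \<tau>) r"
      using that(4) r unfolding f_subset_def f_all_def f_imp_def by blast
  qed (use that preceq_refl in auto)
  have inter: "(\<rho>, q) \<in> F"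
    if "\<rho> \<in> set_names" "q \<in> P" "(\<sigma>, q) \<in> F" "(\<tau>, q) \<in> F"
      "f_all UNIV (\<lambda>n. n \<^bold>\<in> \<rho> \<^bold>\<longleftrightarrow> (n \<^bold>\<in> \<sigma> \<^bold>\<and> n \<^bold>\<in> \<tau>)) q" for \<sigma> \<tau> \<rho> q
  proof (rule finite_meet[of \<rho> q "{(\<sigma>, q), (\<tau>, q)}"])
    fix n r
    assume r: "r \<in> P" "r \<preceq> q" and "\<And>x. x \<in> {(\<sigma>, q), (\<tau>, q)} \<Longrightarrow> (n \<^bold>\<in> fst x) r"
    then have "(n \<^bold>\<in> \<sigma>) r" "(n \<^bold>\<in> \<tau>) r" by force+
    then show "(n \<^bold>\<in> \<rho>) r"
      using that(5) r unfolding f_all_def f_imp_def f_iff_def f_and_def by blast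
  qed (use that preceq_refl in auto)
  show ?thesis
  proof (simp only: f_ultrafilter_def f_and_def, intro conjI)
    show "f_all set_names (\<lambda>\<rho>. f_all UNIV (\<lambda>n. n \<^bold>\<in> \<rho>) \<^bold>\<longrightarrow> \<rho> \<^bold>\<in>\<^bold>\<in> F) p"
      using whole by (simp add: f_all_def f_imp_def iff)
    show "f_all set_names (\<lambda>\<rho>. f_all UNIV (\<lambda>n. \<^bold>\<not> n \<^bold>\<in> \<rho>) \<^bold>\<longrightarrow> (\<^bold>\<not> \<rho> \<^bold>\<in>\<^bold>\<in> F)) p"
      unfolding f_all_def f_imp_def f_not_def
      using empty iff by (meson UNIV_I preceq_trans)
    show "f_all set_names (\<lambda>\<sigma>. f_all set_names (\<lambda>\<tau>.
        \<sigma> \<^bold>\<in>\<^bold>\<in> F \<^bold>\<and> \<sigma> \<^bold>\<subseteq> \<tau> \<^bold>\<longrightarrow> \<tau> \<^bold>\<in>\<^bold>\<in> F)) p"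
      unfolding f_all_def f_imp_def f_and_def using up iff by blast
    show "f_all set_names (\<lambda>\<sigma>. f_all set_names (\<lambda>\<tau>. f_all set_names (\<lambda>\<rho>.
        \<sigma> \<^bold>\<in>\<^bold>\<in> F \<^bold>\<and> \<tau> \<^bold>\<in>\<^bold>\<in> F \<^bold>\<and> f_all UNIV (\<lambda>n. n \<^bold>\<in> \<rho> \<^bold>\<longleftrightarrow> (n \<^bold>\<in> \<sigma> \<^bold>\<and> n \<^bold>\<in> \<tau>)) \<^bold>\<longrightarrow>
        \<rho> \<^bold>\<in>\<^bold>\<in> F))) p"
      using inter iff unfolding f_all_def f_imp_def f_and_def by blast
    show "f_all set_names (\<lambda>\<sigma>. f_all set_names (\<lambda>\<rho>.
        f_all UNIV (\<lambda>n. n \<^bold>\<in> \<rho> \<^bold>\<longleftrightarrow> (\<^bold>\<not> n \<^bold>\<in> \<sigma>)) \<^bold>\<longrightarrow> (\<sigma> \<^bold>\<in>\<^bold>\<in> F \<^bold>\<or> \<rho> \<^bold>\<in>\<^bold>\<in> F))) p"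
      unfolding f_all_def f_imp_def f_or_def dense_below_def
    proof (intro ballI impI)
      fix \<sigma> \<rho> :: "(nat, 'p) set_name" and q q'
      assume \<sigma>\<rho>: "\<sigma> \<in> set_names" "\<rho> \<in> set_names" and q: "q \<in> P" "q' \<in> P" "q' \<preceq> q"
        and compl: "\<forall>n\<in>UNIV. (n \<^bold>\<in> \<rho> \<^bold>\<longleftrightarrow> (\<^bold>\<not> n \<^bold>\<in> \<sigma>)) q"
      have "\<exists>r\<in>P. r \<preceq> q' \<and> ((\<sigma>, r) \<in> F \<or> (\<rho>, r) \<in> F)"
      proof (rule ultra[OF \<sigma>\<rho> q(2)])
        fix n r assume r: "r \<in> P" "r \<preceq> q'" and no: "\<And>r'. r' \<in> P \<Longrightarrow> r' \<preceq> r \<Longrightarrow> \<not> (n \<^bold>\<in> \<sigma>) r'"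
        have "r \<preceq> q" by (rule preceq_trans[OF r(2) q(3) r(1) q(2,1)])
        moreover have "(\<^bold>\<not> n \<^bold>\<in> \<sigma>) r" using no unfolding f_not_def by blast
        ultimately show "(n \<^bold>\<in> \<rho>) r"
          using compl r(1) unfolding f_iff_def f_imp_def f_and_def by blast
      qed
      then show "\<exists>r\<in>P. r \<preceq> q' \<and> r \<in> {r. (\<sigma> \<^bold>\<in>\<^bold>\<in> F) r \<or> (\<rho> \<^bold>\<in>\<^bold>\<in> F) r}"
        using iff \<sigma>\<rho> by blast
    qed
  qed
qed

text \<open>
  The hypothesis on \<open>L\<close> says that \<open>D\<close> and the sets \<open>{m. q m \<in> G}\<close> with \<open>L q \<in> G\<close> are forced to
  have the finite intersection property, since a condition below \<open>q m\<close> for finitely many \<open>q\<close>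
  forces \<open>m\<close> into all the corresponding sets.
\<close>

lemma lim_witness_if_compatible:
  assumes D: "ultrafilter_on_nat D" and "R \<subseteq> P" "Q \<subseteq> P"
    and L: "\<And>q. (\<And>m. q m \<in> Q) \<Longrightarrow> L q \<in> R"
    and compat: "\<And>T A p. finite T \<Longrightarrow> (\<And>q m. q \<in> T \<Longrightarrow> q m \<in> Q) \<Longrightarrow> A \<in> D \<Longrightarrow> p \<in> P \<Longrightarrow>
      (\<And>q. q \<in> T \<Longrightarrow> p \<preceq> L q) \<Longrightarrow> \<exists>m\<in>A. \<exists>r\<in>P. r \<preceq> p \<and> (\<forall>q\<in>T. r \<preceq> q m)"
  shows "\<exists>F. lim_witness D Q R F L"
proof -
  define name where "name q = comprehension_name (\<lambda>m. q m \<^bold>\<in> generic_name)" for q :: "nat \<Rightarrow> 'p"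
  define E where "E = (\<lambda>q. (name q, L q)) ` {q. \<forall>m. q m \<in> Q}"
  have name_mem: "(m \<^bold>\<in> name q) r" if "r \<in> P" "r \<preceq> q m" "q m \<in> P" for m q r
  proof (rule f_memI[of m r "name q"])
    have "(q m \<^bold>\<in> generic_name) r"
      by (rule f_memI[of _ "q m"]) (use that in \<open>auto simp: generic_name_def\<close>)
    then show "(m, r) \<in> name q" using that by (simp add: name_def comprehension_name_def)
  qed (use that preceq_refl in auto)
  have names: "check_family D \<union> E \<in> family_names"
    using L \<open>R \<subseteq> P\<close>
    by (auto simp: family_names_def set_names_def check_family_def check_set_def E_def name_def
        comprehension_name_def)
  have "forced_fip (check_family D \<union> E)"
    unfolding forced_fip_def
  proof (intro allI impI)
    fix S p assume S: "finite S" "S \<subseteq> check_family D \<union> E" and p: "p \<in> P" "\<forall>x\<in>S. p \<preceq> snd x"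
    obtain T where T: "finite T" "T \<subseteq> {q. \<forall>m. q m \<in> Q}" "S \<inter> E = (\<lambda>q. (name q, L q)) ` T"
      using finite_subset_image[of "S \<inter> E" "\<lambda>q. (name q, L q)" "{q. \<forall>m. q m \<in> Q}"] S
      unfolding E_def by auto
    have fin: "finite (fst ` (S \<inter> check_family D))" using S by auto
    have "fst ` (S \<inter> check_family D) \<subseteq> check_set ` D" by (auto simp: check_family_def)
    from finite_subset_image[OF fin this] obtain \<C> where
      \<C>: "\<C> \<subseteq> D" "finite \<C>" "fst ` (S \<inter> check_family D) = check_set ` \<C>"
      by (elim exE conjE)
    have meet: "(\<Inter>X\<in>\<C>. X) \<in> D" using \<C>(1,2) by (intro ultrafilter_INT[OF D]) auto
    have p_le: "p \<preceq> L q" if "q \<in> T" for q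
    proof -
      have "(name q, L q) \<in> S" using T(3) that by blast
      then show ?thesis using p(2) by force
    qed
    have "\<exists>m\<in>(\<Inter>X\<in>\<C>. X). \<exists>r\<in>P. r \<preceq> p \<and> (\<forall>q\<in>T. r \<preceq> q m)"
      using T(2) by (intro compat[OF T(1) _ meet p(1)] p_le) blast+
    then obtain m r where m: "m \<in> (\<Inter>X\<in>\<C>. X)" and r: "r \<in> P" "r \<preceq> p" "\<forall>q\<in>T. r \<preceq> q m"
      by (elim bexE conjE)
    have "(m \<^bold>\<in> fst x) r" if x: "x \<in> S" for x
    proof (cases "x \<in> E")
      case True
      then obtain q where q: "q \<in> T" "x = (name q, L q)" using x T(3) by blast
      then have "q m \<in> P" using T(2) \<open>Q \<subseteq> P\<close> by blast
      then show ?thesis using name_mem[OF r(1)] r(3) q by simp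
    next
      case False
      then have "fst x \<in> check_set ` \<C>" using x S(2) \<C>(3) by blast
      then obtain X where "X \<in> \<C>" "fst x = check_set X" by blast
      then have "(m, r) \<in> fst x" using m r(1) by (simp add: check_set_def)
      then show ?thesis by (rule f_memI[OF _ r(1) r(1) preceq_refl[OF r(1)]])
    qed
    then show "\<exists>r\<in>P. r \<preceq> p \<and> (\<exists>n. \<forall>x\<in>S. (n \<^bold>\<in> fst x) r)" using r by blast
  qed
  from maximal_fip_exists[OF names this] obtain F
    where F: "maximal_fip F" "check_family D \<union> E \<subseteq> F" .
  have "f_subset_family (check_family D) F p" for p
    unfolding f_subset_family_def f_all_def f_imp_def
  proof (intro ballI impI)
    fix \<sigma> q assume "(\<sigma> \<^bold>\<in>\<^bold>\<in> check_family D) q"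
    then show "(\<sigma> \<^bold>\<in>\<^bold>\<in> F) q" by (rule f_mem_family_mono) (use F(2) in simp)
  qed
  moreover have "F \<in> family_names" using F(1) unfolding maximal_fip_def by (rule conjunct1)
  ultimately have "ultrafilter_name_extending D F"
    unfolding ultrafilter_name_extending_def f_and_def
    by (intro conjI ballI maximal_fip_ultrafilter[OF F(1)])
  moreover have "L q \<in> R \<and> (name q \<^bold>\<in>\<^bold>\<in> F) (L q)" if q: "\<forall>m. q m \<in> Q" for q
  proof -
    have "L q \<in> R" using L q by blast
    then have "L q \<in> P" using \<open>R \<subseteq> P\<close> by blast
    moreover have "(name q, L q) \<in> F" using F(2) q unfolding E_def by blast
    ultimately have "(name q \<^bold>\<in>\<^bold>\<in> F) (L q)" using preceq_refl by (intro f_mem_familyI)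
    with \<open>L q \<in> R\<close> show ?thesis by (rule conjI)
  qed
  ultimately have "lim_witness D Q R F L"
    by (simp add: lim_witness_def name_def)
  then show ?thesis by (rule exI)
qed

end


section \<open>Common extensions of localizing conditions\<close>

lemma slalom_bound_mono:
  assumes "slalom_bound b l k \<phi>" "l \<le> l'" "k \<le> k'"
  shows "slalom_bound b l' k' \<phi>"
  unfolding slalom_bound_def
proof (intro allI impI)
  fix n assume "l' \<le> n"
  then have "real (card (\<phi> n)) / real (b n) \<le> 2 powr (- (real n / 2 ^ k))"
    using assms unfolding slalom_bound_def by simp
  also have "\<dots> \<le> 2 powr (- (real n / 2 ^ k'))"
    using assms(3) by (intro powr_mono) (simp_all add: divide_left_mono power_increasing)
  finally show "real (card (\<phi> n)) / real (b n) \<le> 2 powr (- (real n / 2 ^ k'))" .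
qed

text \<open>
  For \<open>n \<ge> card I * 2 ^ (k + 1)\<close> the number of slaloms is at most \<open>2 powr (n / 2 ^ (k + 1))\<close>, which is
  the quotient of the bounds for \<open>k + 1\<close> and for \<open>k\<close>.
\<close>

lemma slalom_bound_UN:
  assumes I: "finite I" and bd: "\<And>i. i \<in> I \<Longrightarrow> slalom_bound b l k (\<phi> i)"
    and l': "l \<le> l'" "card I * 2 ^ (k + 1) \<le> l'"
  shows "slalom_bound b l' (k + 1) (\<lambda>n. \<Union>i\<in>I. \<phi> i n)"
  unfolding slalom_bound_def
proof (intro allI impI)
  fix n assume n: "l' \<le> n"
  have "real (card (\<Union>i\<in>I. \<phi> i n)) / real (b n) \<le> (\<Sum>i\<in>I. real (card (\<phi> i n))) / real (b n)"
    using card_UN_le[OF I, of "\<lambda>i. \<phi> i n"]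
    by (intro divide_right_mono) (simp_all flip: of_nat_sum)
  also have "\<dots> = (\<Sum>i\<in>I. real (card (\<phi> i n)) / real (b n))" by (simp add: sum_divide_distrib)
  also have "\<dots> \<le> (\<Sum>i\<in>I. 2 powr (- (real n / 2 ^ k)))"
    using bd n l'(1) unfolding slalom_bound_def by (intro sum_mono) simp
  also have "\<dots> = real (card I) * 2 powr (- (real n / 2 ^ k))" by simp
  also have "\<dots> \<le> 2 powr (real n / 2 ^ (k + 1)) * 2 powr (- (real n / 2 ^ k))"
  proof (rule mult_right_mono)
    have "real (card I) * 2 ^ (k + 1) = real (card I * 2 ^ (k + 1))" by simp
    also have "\<dots> \<le> real n" using l'(2) n by (simp only: of_nat_le_iff)
    finally have "real (card I) \<le> real n / 2 ^ (k + 1)" by (simp add: pos_le_divide_eq)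
    moreover have "real (card I) \<le> 2 powr real (card I)"
      using of_nat_mono[OF less_imp_le[OF less_exp[of "card I"]], where ?'a = real]
      by (simp add: powr_realpow)
    moreover have "2 powr real (card I) \<le> 2 powr (real n / 2 ^ (k + 1))"
      using calculation(1) by (intro powr_mono) auto
    ultimately show "real (card I) \<le> 2 powr (real n / 2 ^ (k + 1))" by linarith
  qed simp
  also have "\<dots> = 2 powr (- (real n / 2 ^ (k + 1)))"
    by (simp flip: powr_add)
  finally show "real (card (\<Union>i\<in>I. \<phi> i n)) / real (b n) \<le> 2 powr (- (real n / 2 ^ (k + 1)))" .
qed

lemma LE_iff:
  "(d, s, \<phi>) \<in> LE b \<longleftrightarrow> s \<in> bounded_seqs b (length d) \<and> (\<forall>n. \<phi> n \<subseteq> {..<b n}) \<and>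
     (\<exists>k. slalom_bound b (length d) k \<phi>)"
  by (simp add: LE_def)

lemma LE_Q_iff:
  "q \<in> LE_Q b d s k \<longleftrightarrow> s \<in> bounded_seqs b (length d) \<and>
     (\<exists>\<phi>. q = (d, s, \<phi>) \<and> (\<forall>n. \<phi> n \<subseteq> {..<b n}) \<and> slalom_bound b (length d) k \<phi>)"
  by (cases q) (auto simp: LE_Q_def LE_iff)

lemma ones_append_replicate_False: "ones (d @ replicate N False) = ones d"
  by (auto simp: ones_def nth_append split: if_splits)
    (metis add_diff_inverse_nat nat_add_left_cancel_less nth_replicate)

text \<open>
  Appending zeros to the first coordinate creates no obligation, so it is the way to reach a length
  from which on the union of the slaloms is small enough. The appended values in the second coordinate
  are arbitrary.
\<close>

lemma common_extension:
  assumes b: "\<forall>n. 0 < b n"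
    and p: "(d, s, \<psi>) \<in> LE b"
    and A: "finite A" "A \<subseteq> LE b"
    and ext: "\<And>d' s' \<phi>. (d', s', \<phi>) \<in> A \<Longrightarrow>
      prefix d' d \<and> prefix s' s \<and> (\<forall>n\<in>ones d - ones d'. s ! n \<notin> \<phi> n)"
  shows "\<exists>r\<in>LE b. LE_le r (d, s, \<psi>) \<and> (\<forall>q\<in>A. LE_le r q)"
proof -
  define B where "B = insert (d, s, \<psi>) A"
  have B: "finite B" "B \<subseteq> LE b" using A p by (auto simp: B_def)
  have extB: "prefix d' d \<and> prefix s' s \<and> (\<forall>n\<in>ones d - ones d'. s ! n \<notin> \<phi> n)"
    if "(d', s', \<phi>) \<in> B" for d' s' \<phi>
    using that ext unfolding B_def by auto
  have "\<forall>q\<in>B. \<exists>k. slalom_bound b (length d) k (snd (snd q))"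
  proof
    fix q assume q: "q \<in> B"
    obtain d' s' \<phi> where eq: "q = (d', s', \<phi>)" by (rule prod_cases3)
    then obtain k where "slalom_bound b (length d') k \<phi>" using q B(2) LE_iff by blast
    moreover have "length d' \<le> length d" using extB q eq by (blast intro: prefix_length_le)
    ultimately show "\<exists>k. slalom_bound b (length d) k (snd (snd q))"
      using slalom_bound_mono[OF _ _ order.refl, of b "length d'" k \<phi> "length d"] eq by auto
  qed
  then obtain kf where kf: "\<And>q. q \<in> B \<Longrightarrow> slalom_bound b (length d) (kf q) (snd (snd q))"
    by metis
  define k where "k = Max (kf ` B)"
  have bound: "slalom_bound b (length d) k (snd (snd q))" if "q \<in> B" for q
    using slalom_bound_mono[OF kf[OF that] le_refl] B(1) that by (simp add: k_def)
  define N where "N = card B * 2 ^ (k + 1)"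
  define r where "r = (d @ replicate N False, s @ replicate N 0, \<lambda>n. \<Union>q\<in>B. snd (snd q) n)"
  have "s \<in> bounded_seqs b (length d)" using p LE_iff by blast
  then have len: "length s = length d"
    and "s @ replicate N 0 \<in> bounded_seqs b (length (d @ replicate N False))"
    using b by (auto simp: bounded_seqs_def nth_append)
  moreover have "slalom_bound b (length (d @ replicate N False)) (k + 1) (\<lambda>n. \<Union>q\<in>B. snd (snd q) n)"
    by (rule slalom_bound_UN[OF B(1) bound]) (simp_all add: N_def)
  moreover have "(\<Union>q\<in>B. snd (snd q) n) \<subseteq> {..<b n}" for n
    using B(2) by (fastforce simp: LE_def)
  ultimately have "r \<in> LE b" unfolding r_def LE_iff by blast
  moreover have "LE_le r q" if q: "q \<in> B" for q
  proof -
    obtain d' s' \<phi> where eq: "q = (d', s', \<phi>)" by (rule prod_cases3)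
    have "(s @ replicate N 0) ! n \<notin> \<phi> n" if n: "n \<in> ones d - ones d'" for n
    proof -
      have "n < length s" using n len by (simp add: ones_def)
      then show ?thesis using extB[OF q[unfolded eq]] n by (simp add: nth_append)
    qed
    moreover have "prefix d' (d @ replicate N False)" "prefix s' (s @ replicate N 0)"
      using extB[OF q[unfolded eq]] by (auto intro: prefix_prefix)
    moreover have "\<phi> n \<subseteq> (\<Union>q\<in>B. snd (snd q) n)" for n using q eq by force
    ultimately show ?thesis
      unfolding eq r_def LE_le.simps ones_append_replicate_False by blast
  qed
  ultimately show ?thesis unfolding B_def by blast
qed

lemma LE_Q_subset: "LE_Q b d s k \<subseteq> LE b"
  by (auto simp: LE_Q_def)

lemma LE_Q_centered:
  assumes b: "\<forall>n. 0 < b n" and s: "s \<in> bounded_seqs b (length d)"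
  shows "forcing_poset.centered (LE b) LE_le (LE_Q b d s k)"
  unfolding forcing_poset.centered_def[OF LE_forcing_poset]
proof (intro conjI allI impI)
  fix A assume A: "finite A \<and> A \<subseteq> LE_Q b d s k"
  have "(d, s, \<lambda>_. {}) \<in> LE b" using s by (simp add: LE_iff slalom_bound_def)
  then have "\<exists>r\<in>LE b. LE_le r (d, s, \<lambda>_. {}) \<and> (\<forall>q\<in>A. LE_le r q)"
    using A LE_Q_subset[of b d s k] by (intro common_extension b) (auto simp: LE_Q_iff)
  then show "\<exists>p\<in>LE b. \<forall>q\<in>A. LE_le p q" by blast
qed (rule LE_Q_subset)


section \<open>Limits of conditions along an ultrafilter\<close>

definition slalom_lim :: "nat set set \<Rightarrow> (nat \<Rightarrow> nat \<Rightarrow> nat set) \<Rightarrow> nat \<Rightarrow> nat set" where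
  "slalom_lim D \<phi> n = {i. {m. i \<in> \<phi> m n} \<in> D}"

text \<open>
  The sets \<open>\<phi> m n\<close> take finitely many values, so one of them is taken for \<open>D\<close>-many \<open>m\<close>, and this
  value is the limit. Every bound that holds for all \<open>\<phi> m n\<close> is therefore inherited by the limit.
\<close>

lemma slalom_lim_attained:
  assumes D: "ultrafilter_on_nat D" and X: "finite X" "\<And>m. \<phi> m n \<subseteq> X"
  shows "\<exists>m. slalom_lim D \<phi> n = \<phi> m n"
proof -
  have "range (\<lambda>m. \<phi> m n) \<subseteq> Pow X" using X(2) by blast
  then have "finite (range (\<lambda>m. \<phi> m n))" using X(1) by (metis finite_Pow_iff finite_subset)
  from ultrafilter_pigeonhole[OF D this] obtain Y where Y: "{m. \<phi> m n = Y} \<in> D" by blast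
  then obtain m where m: "\<phi> m n = Y" using ultrafilter_nonempty[OF D] by blast
  have "{m. i \<in> \<phi> m n} \<in> D \<longleftrightarrow> i \<in> Y" for i
  proof
    assume "i \<in> Y"
    then show "{m. i \<in> \<phi> m n} \<in> D" by (intro ultrafilter_mono[OF D Y]) blast
  next
    assume "{m. i \<in> \<phi> m n} \<in> D"
    with Y have "{m. i \<in> \<phi> m n} \<inter> {m. \<phi> m n = Y} \<noteq> {}"
      using ultrafilter_Int[OF D] ultrafilter_nonempty[OF D] by blast
    then show "i \<in> Y" by blast
  qed
  then show ?thesis using m by (auto simp: slalom_lim_def)
qed

definition LE_lim :: "nat set set \<Rightarrow> bool list \<Rightarrow> nat list \<Rightarrow> (nat \<Rightarrow> le_condition) \<Rightarrow> le_condition" where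
  "LE_lim D d s q = (d, s, slalom_lim D (\<lambda>m. snd (snd (q m))))"

lemma LE_lim_in_LE_Q:
  assumes D: "ultrafilter_on_nat D" and q: "\<And>m. q m \<in> LE_Q b d s k"
  shows "LE_lim D d s q \<in> LE_Q b d s k"
proof -
  define \<phi> where "\<phi> m = snd (snd (q m))" for m
  have \<phi>: "\<phi> m n \<subseteq> {..<b n}" "slalom_bound b (length d) k (\<phi> m)" for m n
  proof -
    from q[of m] obtain \<psi> where "q m = (d, s, \<psi>)" "\<forall>n. \<psi> n \<subseteq> {..<b n}"
        "slalom_bound b (length d) k \<psi>"
      unfolding LE_Q_iff by blast
    then show "\<phi> m n \<subseteq> {..<b n}" "slalom_bound b (length d) k (\<phi> m)" by (simp_all add: \<phi>_def)
  qed
  have att: "\<exists>m. slalom_lim D \<phi> n = \<phi> m n" for n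
    by (rule slalom_lim_attained[OF D finite_lessThan \<phi>(1)])
  have "slalom_bound b (length d) k (slalom_lim D \<phi>)"
    using att \<phi>(2) unfolding slalom_bound_def by metis
  moreover have "slalom_lim D \<phi> n \<subseteq> {..<b n}" for n using att \<phi>(1) by metis
  moreover have "s \<in> bounded_seqs b (length d)" using q LE_Q_iff by blast
  ultimately show ?thesis unfolding LE_Q_iff LE_lim_def \<phi>_def by blast
qed

lemma LE_lim_compatible:
  assumes b: "\<forall>n. 0 < b n" and D: "ultrafilter_on_nat D"
    and T: "finite T" "\<And>q m. q \<in> T \<Longrightarrow> q m \<in> LE_Q b d s k"
    and A: "A \<in> D" and p: "p \<in> LE b" "\<And>q. q \<in> T \<Longrightarrow> LE_le p (LE_lim D d s q)"
  shows "\<exists>m\<in>A. \<exists>r\<in>LE b. LE_le r p \<and> (\<forall>q\<in>T. LE_le r (q m))"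
proof -
  obtain d' s' \<psi> where eq: "p = (d', s', \<psi>)" by (rule prod_cases3)
  define \<phi> where "\<phi> q m = snd (snd (q m))" for q :: "nat \<Rightarrow> le_condition" and m
  have q_eq: "q m = (d, s, \<phi> q m)" if "q \<in> T" for q m
    using T(2)[OF that, of m] by (auto simp: LE_Q_iff \<phi>_def)
  have le: "prefix d d'" "prefix s s'" "\<And>n. n \<in> ones d' - ones d \<Longrightarrow> s' ! n \<notin> slalom_lim D (\<phi> q) n"
    if "q \<in> T" for q
    using p(2)[OF that] unfolding eq LE_lim_def \<phi>_def LE_le.simps by blast+
  define J where "J = T \<times> (ones d' - ones d)"
  define good where "good = (\<Inter>(q, n)\<in>J. {m. s' ! n \<notin> \<phi> q m n})"
  have "finite (ones d')" by (simp add: ones_def)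
  then have J: "finite J" using T(1) by (simp add: J_def)
  have "good \<in> D"
    unfolding good_def
  proof (rule ultrafilter_INT[OF D J], clarify)
    fix q n assume qn: "(q, n) \<in> J"
    then have "{m. s' ! n \<in> \<phi> q m n} \<notin> D" using le(3) by (auto simp: J_def slalom_lim_def)
    from ultrafilter_Compl[OF D this] show "{m. s' ! n \<notin> \<phi> q m n} \<in> D" by (simp add: Collect_neg_eq)
  qed
  then obtain m where m: "m \<in> A" "m \<in> good"
    using ultrafilter_Int[OF D A] ultrafilter_nonempty[OF D] by blast
  have "\<exists>r\<in>LE b. LE_le r (d', s', \<psi>) \<and> (\<forall>q\<in>(\<lambda>q. q m) ` T. LE_le r q)"
  proof (rule common_extension[OF b p(1)[unfolded eq]])
    show "(\<lambda>q. q m) ` T \<subseteq> LE b" using T(2) LE_Q_subset by blast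
    fix d0 s0 \<phi>0 assume "(d0, s0, \<phi>0) \<in> (\<lambda>q. q m) ` T"
    then obtain q where q: "q \<in> T" "d0 = d" "s0 = s" "\<phi>0 = \<phi> q m"
      using q_eq unfolding image_iff by (metis Pair_inject)
    moreover have "s' ! n \<notin> \<phi> q m n" if "n \<in> ones d' - ones d" for n
      using m(2) that q(1) unfolding good_def J_def by blast
    ultimately show "prefix d0 d' \<and> prefix s0 s' \<and> (\<forall>n\<in>ones d' - ones d0. s' ! n \<notin> \<phi>0 n)"
      using le(1,2) by blast
  qed (use T in simp)
  then show ?thesis using m(1) eq by blast
qed

lemma LE_Q_closed_lim_linked:
  assumes b: "\<forall>n. 0 < b n" and D: "ultrafilter_on_nat D"
  shows "forcing_poset.closed_lim_linked (LE b) LE_le D (LE_Q b d s k)"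
proof -
  interpret forcing_poset "LE b" LE_le by (rule LE_forcing_poset)
  have "\<exists>F. lim_witness D (LE_Q b d s k) (LE_Q b d s k) F (LE_lim D d s)"
    by (rule lim_witness_if_compatible[OF D LE_Q_subset LE_Q_subset])
      (fact LE_lim_in_LE_Q[OF D] LE_lim_compatible[OF b D])+
  then have "\<exists>F L. lim_witness D (LE_Q b d s k) (LE_Q b d s k) F L" by (elim exE) (intro exI)
  then show ?thesis unfolding closed_lim_linked_def by (intro conjI LE_Q_subset)
qed

theorem lemma4p29:
  fixes b :: "nat \<Rightarrow> nat"
  assumes "\<forall>n. b n \<ge> 2 ^ n"
  shows "(\<forall>d s k D. s \<in> bounded_seqs b (length d) \<and> nonprincipal_ultrafilter D \<longrightarrow>
            forcing_poset.closed_lim_linked (LE b) LE_le D (LE_Q b d s k)) \<and>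
         forcing_poset.sigma_linked (LE b)
           (forcing_poset.Lambda_centered (LE b) LE_le \<inter>
            forcing_poset.Lambda_lim_cuf (LE b) LE_le)"
proof -
  interpret forcing_poset "LE b" LE_le by (rule LE_forcing_poset)
  have b: "\<forall>n. 0 < b n"
  proof
    fix n
    have "0 < (2::nat) ^ n" by simp
    also have "\<dots> \<le> b n" using assms by (rule spec)
    finally show "0 < b n" .
  qed
  have closed: "closed_lim_linked D (LE_Q b d s k)" if "nonprincipal_ultrafilter D" for D d s k
    by (rule LE_Q_closed_lim_linked[OF b])
      (use that in \<open>simp add: nonprincipal_ultrafilter_def\<close>)
  define \<Q> where "\<Q> = (\<lambda>(d, s, k). LE_Q b d s k) ` {(d, s, k). s \<in> bounded_seqs b (length d)}"
  have "countable \<Q>"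
    unfolding \<Q>_def by (rule countable_image) (rule countableI_type)
  moreover have "\<Q> \<subseteq> Lambda_centered \<inter> Lambda_lim_cuf"
  proof
    fix Q assume "Q \<in> \<Q>"
    then obtain d s k where s: "s \<in> bounded_seqs b (length d)" and Q: "Q = LE_Q b d s k"
      unfolding \<Q>_def by auto
    have "centered Q" unfolding Q by (rule LE_Q_centered[OF b s])
    moreover have "\<forall>D. nonprincipal_ultrafilter D \<longrightarrow> closed_lim_linked D Q"
      unfolding Q by (intro allI impI closed)
    ultimately show "Q \<in> Lambda_centered \<inter> Lambda_lim_cuf"
      unfolding Lambda_centered_def Lambda_lim_cuf_def by (intro IntI CollectI)
  qed
  moreover have "\<Union>\<Q> = LE b"
  proof
    show "\<Union>\<Q> \<subseteq> LE b" unfolding \<Q>_def by (auto dest: subsetD[OF LE_Q_subset])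
    show "LE b \<subseteq> \<Union>\<Q>"
    proof
      fix q assume "q \<in> LE b"
      moreover obtain d s \<phi> where q: "q = (d, s, \<phi>)" by (rule prod_cases3)
      ultimately obtain k where "s \<in> bounded_seqs b (length d)" "q \<in> LE_Q b d s k"
        unfolding q LE_Q_iff LE_iff by blast
      then show "q \<in> \<Union>\<Q>" unfolding \<Q>_def by blast
    qed
  qed
  ultimately have "sigma_linked (Lambda_centered \<inter> Lambda_lim_cuf)"
    unfolding sigma_linked_def by (intro exI conjI)
  then show ?thesis by (intro conjI allI impI closed) simp
qed

end
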